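(* Let $\mathfrak X_n$ be a non-commutative rank 6 association scheme of order $n=3(m+1)$, $3\mid (m-1)$, with three thin relations $R_0,R_1,R_2$ and three thick relations $\Delta_0,\Delta_1,\Delta_2$ of valency $m$ satisfying the multiplication table given in the context. Choose any fiber as the island and let $J_{n,0}$ be the rank 5 color graph obtained by the switching $Sw_0$, i.e. the color graph with basic relations $\mathrm{Id}_n$, $\mathrm{Spr}_n=R_1\cup R_2$, $\Delta_0$, $\Delta'_{0,1}=T_1\cup Br_2$, $\Delta'_{0,2}=T_2\cup Br_1$. Then the rank 5 Jordan scheme $J_{n,0}$ is a proper Jordan scheme.
   Context: Relations on a finite set are identified with their 0/1 adjacency matrices. An association scheme (AS) on a finite set $\Omega$ is a partition of $\Omega^2$ into nonempty relations, one of which is the identity relation, closed under transposition, whose adjacency matrices span a matrix algebra (closed under the usual product); it may be non-symmetric and non-commutative. Its rank is the number of relations. A Jordan scheme on $\Omega$ is a partition of $\Omega^2$ into nonempty symmetric relations, one of which is the identity relation, such that the real linear span of the adjacency matrices is closed under the Jordan product $A*B=\frac12(AB+BA)$. The symmetrization of an AS is obtained by replacing each relation $R$ by $R\cup R^T$. A Jordan scheme is non-proper if it is the symmetrization of some AS, and proper otherwise. Setting: $\mathfrak X_n=(\Omega,\{R_0,R_1,R_2,\Delta_0,\Delta_1,\Delta_2\})$ with $|\Omega|=n=3(m+1)$, $m>1$, $3\mid(m-1)$, $R_0=\mathrm{Id}_\Omega$; the $R_i$ have valency 1 and the $\Delta_i$ have valency $m$; with indices modulo 3, $$R_iR_j=R_{i+j},\quad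 R_i\Delta_j=\Delta_{i+j},\quad \Delta_jR_i=\Delta_{j-i},\quad \Delta_i\Delta_j=mR_{i-j}+\tfrac{m-1}{3}(\Delta_0+\Delta_1+\Delta_2).$$ The relation $R_0\cup R_1\cup R_2$ is an equivalence relation with $m+1$ classes of size 3, called fibers. Fix one fiber, the island; the union of all other fibers (of size $3m$) is the continent. $T_i$ denotes the restriction of $\Delta_i$ to the continent, and the bridge $Br_i$ is the set of all pairs of $\Delta_i$ (in both directions) with one entry on the island and the other on the continent. One has $\Delta_i=T_i\cup Br_i$. *)

theory Defs
  imports "HOL-Analysis.Analysis" "HOL-Library.Disjoint_Sets"
begin

text \<open>
  The point set \<open>\<Omega>\<close> is the universe of a finite type \<open>'v\<close>. A color graph on \<open>\<Omega>\<close> is given by its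
  set of basic relations.
\<close>

definition adj :: "('v::finite) rel \<Rightarrow> real^'v^'v" where
  "adj R = (\<chi> x y. if (x, y) \<in> R then 1 else 0)"

definition color_graph :: "('v::finite) rel set \<Rightarrow> bool" where
  "color_graph C \<longleftrightarrow> partition_on UNIV C \<and> Id \<in> C"

definition scheme_rank :: "('v::finite) rel set \<Rightarrow> nat" where
  "scheme_rank C = card C"

definition has_valency :: "('v::finite) rel \<Rightarrow> nat \<Rightarrow> bool" where
  "has_valency R k \<longleftrightarrow> (\<forall>x. card (R `` {x}) = k)"

definition association_scheme :: "('v::finite) rel set \<Rightarrow> bool" where
  "association_scheme C \<longleftrightarrow>
     color_graph C \<and> (\<forall>R\<in>C. R\<inverse> \<in> C) \<and>
     (\<forall>A\<in>span (adj ` C). \<forall>B\<in>span (adj ` C). A ** B \<in> span (adj ` C))"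

definition commutative_scheme :: "('v::finite) rel set \<Rightarrow> bool" where
  "commutative_scheme C \<longleftrightarrow>
     (\<forall>A\<in>span (adj ` C). \<forall>B\<in>span (adj ` C). A ** B = B ** A)"

definition jordan_product :: "real^'v^'v \<Rightarrow> real^'v^'v \<Rightarrow> real^('v::finite)^'v" where
  "jordan_product A B = (1/2) *\<^sub>R (A ** B + B ** A)"

definition jordan_scheme :: "('v::finite) rel set \<Rightarrow> bool" where
  "jordan_scheme C \<longleftrightarrow>
     color_graph C \<and> (\<forall>R\<in>C. sym R) \<and>
     (\<forall>A\<in>span (adj ` C). \<forall>B\<in>span (adj ` C). jordan_product A B \<in> span (adj ` C))"

definition symmetrization :: "('v::finite) rel set \<Rightarrow> 'v rel set" where
  "symmetrization C = (\<lambda>R. R \<union> R\<inverse>) ` C"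

definition proper_jordan_scheme :: "('v::finite) rel set \<Rightarrow> bool" where
  "proper_jordan_scheme C \<longleftrightarrow>
     jordan_scheme C \<and> \<not> (\<exists>A. association_scheme A \<and> C = symmetrization A)"

text \<open>
  The three thin relations \<open>R i\<close> and the three thick relations \<open>\<Delta> i\<close> are indexed by the
  type \<open>3\<close>, whose arithmetic is that of the integers modulo 3.
\<close>

definition thin_thick_scheme ::
    "nat \<Rightarrow> (3 \<Rightarrow> ('v::finite) rel) \<Rightarrow> (3 \<Rightarrow> 'v rel) \<Rightarrow> bool" where
  "thin_thick_scheme m R \<Delta> \<longleftrightarrow>
     association_scheme {R 0, R 1, R 2, \<Delta> 0, \<Delta> 1, \<Delta> 2} \<and>
     scheme_rank {R 0, R 1, R 2, \<Delta> 0, \<Delta> 1, \<Delta> 2} = 6 \<and>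
     \<not> commutative_scheme {R 0, R 1, R 2, \<Delta> 0, \<Delta> 1, \<Delta> 2} \<and>
     R 0 = Id \<and>
     (\<forall>i. has_valency (R i) 1) \<and>
     (\<forall>i. has_valency (\<Delta> i) m) \<and>
     (\<forall>i j. adj (R i) ** adj (R j) = adj (R (i + j))) \<and>
     (\<forall>i j. adj (R i) ** adj (\<Delta> j) = adj (\<Delta> (i + j))) \<and>
     (\<forall>i j. adj (\<Delta> j) ** adj (R i) = adj (\<Delta> (j - i))) \<and>
     (\<forall>i j. adj (\<Delta> i) ** adj (\<Delta> j) =
        real m *\<^sub>R adj (R (i - j)) +
        ((real m - 1) / 3) *\<^sub>R (adj (\<Delta> 0) + adj (\<Delta> 1) + adj (\<Delta> 2)))"

definition fibers :: "(3 \<Rightarrow> ('v::finite) rel) \<Rightarrow> 'v set set" where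
  "fibers R = UNIV // (R 0 \<union> R 1 \<union> R 2)"

definition continent :: "(3 \<Rightarrow> ('v::finite) rel) \<Rightarrow> 'v set \<Rightarrow> 'v set" where
  "continent R island = \<Union> (fibers R - {island})"

definition continent_part ::
    "(3 \<Rightarrow> ('v::finite) rel) \<Rightarrow> (3 \<Rightarrow> 'v rel) \<Rightarrow> 'v set \<Rightarrow> 3 \<Rightarrow> 'v rel" where
  "continent_part R \<Delta> island i = \<Delta> i \<inter> (continent R island \<times> continent R island)"

definition bridge ::
    "(3 \<Rightarrow> ('v::finite) rel) \<Rightarrow> (3 \<Rightarrow> 'v rel) \<Rightarrow> 'v set \<Rightarrow> 3 \<Rightarrow> 'v rel" where
  "bridge R \<Delta> island i =
     \<Delta> i \<inter> (island \<times> continent R island \<union> continent R island \<times> island)"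

definition switching0 ::
    "(3 \<Rightarrow> ('v::finite) rel) \<Rightarrow> (3 \<Rightarrow> 'v rel) \<Rightarrow> 'v set \<Rightarrow> 'v rel set" where
  "switching0 R \<Delta> island =
     {Id, R 1 \<union> R 2, \<Delta> 0,
      continent_part R \<Delta> island 1 \<union> bridge R \<Delta> island 2,
      continent_part R \<Delta> island 2 \<union> bridge R \<Delta> island 1}"

end

theory Submission imports Defs begin

text \<open>
  The switching keeps every \<open>\<Delta> i\<close> on the continent and negates the index modulo 3 on the bridge; this
  also describes \<open>\<Delta> 0\<close>, so the three thick relations of the switched graph are \<open>switched i\<close> for \<open>i\<close>
  modulo 3. Fibers contain no thick pairs, and \<open>\<Delta> i\<close> is symmetric because the diagonal of
  \<open>\<Delta> i \<Delta> i\<close> is its valency.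

  \<^bold>\<open>The graph is a Jordan scheme.\<close> Compare the product of \<open>switched i\<close> and \<open>switched j\<close> at \<open>(x, y)\<close> with
  products in the original scheme. If \<open>x\<close> or \<open>y\<close> is on the island, it is the entry of
  \<open>\<Delta> (\<plusminus>i) \<Delta> (\<plusminus>j)\<close>, with signs depending on the sides of \<open>x\<close> and \<open>y\<close>. If both are on the continent, it is
  the entry of \<open>\<Delta> i \<Delta> j\<close> up to a correction: the paths from \<open>x\<close> to \<open>y\<close> through the island
  have the colors \<open>- i, - j\<close> in place of \<open>i, j\<close>. A thin relation permutes the island and shifts both
  colors of a path by the same amount, so there are as many paths through the island with
  colors \<open>i, j\<close> as with colors \<open>- j, - i\<close> (\<open>paths_via_island_reflect\<close>). Hence the correction is
  antisymmetric in \<open>i\<close> and \<open>j\<close> and vanishes in the Jordan product, which is the same linear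
  combination as before the switching (\<open>switched_anticommutator\<close>). The products with the fiber
  relation are unchanged too, since a fiber lies on one side.

  \<^bold>\<open>The scheme is proper.\<close> The correction survives in the ordinary product of \<open>switched 0\<close> and
  \<open>switched 1\<close>. Inside the island this product has an entry \<open>m\<close>, but between distinct points of a
  fiber of the continent its entries are only \<open>1\<close> and \<open>m - 1\<close>. If the graph were the symmetrization of
  an association scheme, the product would lie in the algebra of that scheme and so be constant on
  its relations. The relation through an island pair with entry \<open>m\<close> is contained in
  \<open>R 1 \<union> R 2\<close>, and having constant valency it has pairs starting on the continent
  (\<open>symmetrization_row_values\<close>), where the entry \<open>m\<close> does not occur.
\<close>

section \<open>Adjacency matrices and coherence\<close>

lemma adj_nth [simp]: "adj S $ x $ y = (if (x, y) \<in> S then 1 else 0)"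
  by (simp add: adj_def)

lemma matrix_mul_nth: "(A ** B) $ x $ y = (\<Sum>z\<in>UNIV. A $ x $ z * B $ z $ y)"
  by (simp add: matrix_matrix_mult_def)

lemma transpose_adj: "transpose (adj S) = adj (S\<inverse>)"
  by (simp add: vec_eq_iff transpose_def)

lemma adj_mul_pos_iff: "(adj A ** adj B) $ x $ z > 0 \<longleftrightarrow> (\<exists>y. (x, y) \<in> A \<and> (y, z) \<in> B)"
proof -
  have "(adj A ** adj B) $ x $ z = (\<Sum>y\<in>UNIV. if (x, y) \<in> A \<and> (y, z) \<in> B then 1 else 0)"
    unfolding matrix_mul_nth by (rule sum.cong) auto
  also have "\<dots> = real (card {y. (x, y) \<in> A \<and> (y, z) \<in> B})"
    by (simp add: sum.If_cases)
  finally show ?thesis by (auto simp: card_gt_0_iff)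
qed

lemma adj_mul_eq_adj_comp:
  assumes "adj A ** adj B = adj C" "(x, y) \<in> A" "(y, z) \<in> B"
  shows "(x, z) \<in> C"
proof -
  have "(adj A ** adj B) $ x $ z > 0" unfolding adj_mul_pos_iff using assms(2,3) by blast
  then show ?thesis unfolding assms(1) by (simp split: if_splits)
qed

lemma color_graph_disjoint:
  assumes "color_graph C" "P \<in> C" "Q \<in> C" "(x, y) \<in> P" "(x, y) \<in> Q"
  shows "P = Q"
  using assms unfolding color_graph_def partition_on_def disjoint_def by blast

lemma span_adj_constant:
  assumes "color_graph C" "M \<in> span (adj ` C)" "P \<in> C" "(x, y) \<in> P" "(u, v) \<in> P"
  shows "M $ x $ y = M $ u $ v"
  using assms(2)
proof (rule span_induct)
  show "subspace {M. M $ x $ y = M $ u $ v}"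
    by (auto simp: subspace_def)
  fix M assume "M \<in> adj ` C"
  then obtain Q where Q: "Q \<in> C" "M = adj Q" by blast
  have "(x, y) \<in> Q \<longleftrightarrow> (u, v) \<in> Q"
    using color_graph_disjoint[OF assms(1,3) Q(1)] assms(4,5) by metis
  then show "M $ x $ y = M $ u $ v" using Q(2) by simp
qed

text \<open>
  The diagonal is a single relation of an association scheme, so the out-degree of a relation \<open>P\<close>,
  being the diagonal entry of \<open>adj P ** adj (P\<inverse>)\<close>, is the same at all points.
\<close>

lemma association_scheme_out_neighbour:
  assumes "association_scheme C" "P \<in> C" "(x, y) \<in> P"
  obtains v where "(u, v) \<in> P"
proof -
  have cg: "color_graph C" and "P\<inverse> \<in> C"
    using assms by (auto simp: association_scheme_def)
  then have "adj P ** adj (P\<inverse>) \<in> span (adj ` C)"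
    using assms(1,2) unfolding association_scheme_def by (meson image_eqI span_base)
  moreover have "Id \<in> C" using cg by (simp add: color_graph_def)
  ultimately have "(adj P ** adj (P\<inverse>)) $ u $ u = (adj P ** adj (P\<inverse>)) $ x $ x"
    using span_adj_constant[OF cg] by blast
  also have "\<dots> > 0" unfolding adj_mul_pos_iff using assms(3) by blast
  finally obtain v where "(u, v) \<in> P" unfolding adj_mul_pos_iff by blast
  then show ?thesis by (rule that)
qed

lemma symmetrization_in_span:
  assumes "association_scheme C" "S \<in> symmetrization C"
  shows "adj S \<in> span (adj ` C)"
proof -
  obtain P where P: "P \<in> C" "S = P \<union> P\<inverse>"
    using assms(2) by (auto simp: symmetrization_def)
  have cg: "color_graph C" and P': "P\<inverse> \<in> C"
    using assms(1) P by (auto simp: association_scheme_def)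
  show ?thesis
  proof (cases "P = P\<inverse>")
    case True
    then show ?thesis using P by (auto intro: span_base)
  next
    case False
    then have "P \<inter> P\<inverse> = {}" using color_graph_disjoint[OF cg P(1) P'] by auto
    then have "adj S = adj P + adj (P\<inverse>)" unfolding P(2) by (auto simp: vec_eq_iff)
    then show ?thesis using P P' by (auto intro: span_add span_base)
  qed
qed

text \<open>
  In an association scheme with symmetrization \<open>C\<close> any product of two matrices of \<open>C\<close> is constant
  on the relations of the scheme. Each value that such a product takes on a relation of \<open>C\<close> is
  therefore taken, within that relation, in the row of every point.
\<close>

lemma symmetrization_row_values:
  assumes "association_scheme A" "C = symmetrization A"
    and "color_graph C" "S \<in> C" "T \<in> C" "U \<in> C" "(x, y) \<in> U"
  obtains v where "(u, v) \<in> U" "(adj S ** adj T) $ u $ v = (adj S ** adj T) $ x $ y"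
proof -
  have cg: "color_graph A" using assms(1) by (simp add: association_scheme_def)
  have "adj S \<in> span (adj ` A)" "adj T \<in> span (adj ` A)"
    using assms(1,2,4,5) symmetrization_in_span by blast+
  then have M: "adj S ** adj T \<in> span (adj ` A)"
    using assms(1) unfolding association_scheme_def by blast
  have "\<Union> A = UNIV" using cg by (simp add: color_graph_def partition_on_def)
  then have "(x, y) \<in> \<Union> A" by simp
  then obtain P where P: "P \<in> A" "(x, y) \<in> P" by blast
  have "P \<union> P\<inverse> \<in> C" using P(1) assms(2) by (auto simp: symmetrization_def)
  then have PU: "P \<union> P\<inverse> = U"
    using color_graph_disjoint[OF assms(3) _ assms(6) _ assms(7)] P(2) by blast
  obtain v where v: "(u, v) \<in> P"
    using association_scheme_out_neighbour[OF assms(1) P] .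
  show ?thesis
  proof (rule that)
    show "(u, v) \<in> U" using v PU by blast
    show "(adj S ** adj T) $ u $ v = (adj S ** adj T) $ x $ y"
      by (rule span_adj_constant[OF cg M P(1) v P(2)])
  qed
qed

section \<open>The Jordan product on a span\<close>

lemma jordan_product_commute: "jordan_product A B = jordan_product B A"
  by (simp add: jordan_product_def add.commute)

lemma matrix_mul_scaleR_left: "(c *\<^sub>R A) ** B = c *\<^sub>R (A ** B)" for A B :: "real^'n^'n"
  by (simp add: vec_eq_iff matrix_mul_nth sum_distrib_left mult.assoc)

lemma matrix_mul_scaleR_right: "A ** (c *\<^sub>R B) = c *\<^sub>R (A ** B)" for A B :: "real^'n^'n"
  by (simp add: vec_eq_iff matrix_mul_nth sum_distrib_left mult.left_commute)

lemma matrix_add_rdistrib: "(A + B) ** C = A ** C + B ** C" for A B C :: "real^'n^'n"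
  by (simp add: vec_eq_iff matrix_mul_nth sum.distrib distrib_right)

lemma linear_jordan_product: "linear (jordan_product A)"
  by (rule linearI)
    (simp_all add: jordan_product_def matrix_add_ldistrib matrix_add_rdistrib
      matrix_mul_scaleR_left matrix_mul_scaleR_right algebra_simps)

lemma jordan_product_span_right:
  assumes "\<And>B. B \<in> G \<Longrightarrow> jordan_product A B \<in> span H" "B \<in> span G"
  shows "jordan_product A B \<in> span H"
  using assms(2)
proof (rule span_induct)
  show "subspace {B. jordan_product A B \<in> span H}"
    using linear_subspace_vimage[OF linear_jordan_product[of A] subspace_span[of H]]
    by (simp add: vimage_def)
qed (rule assms(1))

lemma jordan_product_span:
  assumes "\<And>A B. A \<in> G \<Longrightarrow> B \<in> G \<Longrightarrow> jordan_product A B \<in> span G"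
    and "A \<in> span G" "B \<in> span G"
  shows "jordan_product A B \<in> span G"
proof (rule jordan_product_span_right[OF _ assms(3)])
  fix B assume "B \<in> G"
  then have "jordan_product B A \<in> span G"
    using jordan_product_span_right[OF _ assms(2)] assms(1) by blast
  then show "jordan_product A B \<in> span G" by (simp only: jordan_product_commute[of A B])
qed

section \<open>The combinatorics of the scheme\<close>

lemma exhaust_mod_3: "k = 0 \<or> k = 1 \<or> k = 2" for k :: 3
  using exhaust_3[of k] by auto

lemma univ_mod_3: "(UNIV :: 3 set) = {0, 1, 2}"
  using exhaust_mod_3 by auto

lemma uminus_mod_3: "- 1 = (2 :: 3)" "- 2 = (1 :: 3)"
  by (rule minus_unique, simp)+

lemma sum_mod_3: "sum f (UNIV :: 3 set) = f 0 + f 1 + f 2" for f :: "3 \<Rightarrow> 'a::comm_monoid_add"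
  unfolding univ_mod_3 by (simp add: add.assoc)

lemma sum_uminus_mod_3: "(\<Sum>i\<in>UNIV. f (- i)) = (\<Sum>i\<in>UNIV. f i)"
  for f :: "3 \<Rightarrow> 'a::comm_monoid_add"
  by (rule sum.reindex_bij_witness[where i = uminus and j = uminus]) auto

lemma sum_shift_mod_3: "(\<Sum>i\<in>UNIV. f (i + k)) = (\<Sum>i\<in>UNIV. f i)"
  for f :: "3 \<Rightarrow> 'a::comm_monoid_add"
  by (rule sum.reindex_bij_witness[where i = "\<lambda>i. i - k" and j = "\<lambda>i. i + k"]) auto

locale island_switching =
  fixes R \<Delta> :: "3 \<Rightarrow> ('v::finite) rel" and m :: nat and island :: "'v set"
  assumes m_gt_1: "m > 1"
    and scheme: "thin_thick_scheme m R \<Delta>"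
    and island_fiber: "island \<in> fibers R"
begin

definition same_fiber :: "'v rel" where
  "same_fiber = R 0 \<union> R 1 \<union> R 2"

lemma same_fiber_iff: "(x, y) \<in> same_fiber \<longleftrightarrow> (\<exists>k. (x, y) \<in> R k)"
  unfolding same_fiber_def using exhaust_mod_3 by (metis Un_iff)

lemma R_0: "R 0 = Id"
  and R_valency [rule_format]: "\<forall>i. has_valency (R i) 1"
  and \<Delta>_valency [rule_format]: "\<forall>i. has_valency (\<Delta> i) m"
  and adj_R_mul_R [rule_format]: "\<forall>i j. adj (R i) ** adj (R j) = adj (R (i + j))"
  and adj_R_mul_\<Delta> [rule_format]: "\<forall>i j. adj (R i) ** adj (\<Delta> j) = adj (\<Delta> (i + j))"
  and adj_\<Delta>_mul_R [rule_format]: "\<forall>i j. adj (\<Delta> j) ** adj (R i) = adj (\<Delta> (j - i))"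
  and adj_\<Delta>_mul_\<Delta> [rule_format]: "\<forall>i j. adj (\<Delta> i) ** adj (\<Delta> j) =
    real m *\<^sub>R adj (R (i - j)) + ((real m - 1) / 3) *\<^sub>R (adj (\<Delta> 0) + adj (\<Delta> 1) + adj (\<Delta> 2))"
  using scheme unfolding thin_thick_scheme_def by - (elim conjE, assumption)+

lemma color_graph_scheme: "color_graph {R 0, R 1, R 2, \<Delta> 0, \<Delta> 1, \<Delta> 2}"
  using scheme unfolding thin_thick_scheme_def association_scheme_def by (elim conjE)

lemma relations_distinct: "distinct [R 0, R 1, R 2, \<Delta> 0, \<Delta> 1, \<Delta> 2]"
proof (rule card_distinct)
  show "card (set [R 0, R 1, R 2, \<Delta> 0, \<Delta> 1, \<Delta> 2]) = length [R 0, R 1, R 2, \<Delta> 0, \<Delta> 1, \<Delta> 2]"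
    using scheme unfolding thin_thick_scheme_def scheme_rank_def by (elim conjE) simp
qed

lemma R_mem: "R k \<in> {R 0, R 1, R 2, \<Delta> 0, \<Delta> 1, \<Delta> 2}"
  using exhaust_mod_3[of k] by auto

lemma \<Delta>_mem: "\<Delta> k \<in> {R 0, R 1, R 2, \<Delta> 0, \<Delta> 1, \<Delta> 2}"
  using exhaust_mod_3[of k] by auto

lemma R_eq_iff: "R i = R j \<longleftrightarrow> i = j"
  and \<Delta>_eq_iff: "\<Delta> i = \<Delta> j \<longleftrightarrow> i = j"
  and R_neq_\<Delta>: "R i \<noteq> \<Delta> j"
proof -
  have "\<forall>i\<in>UNIV. \<forall>j\<in>UNIV. (R i = R j \<longleftrightarrow> i = j) \<and> (\<Delta> i = \<Delta> j \<longleftrightarrow> i = j) \<and> R i \<noteq> \<Delta> j"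
    unfolding univ_mod_3 using relations_distinct by simp metis
  then show "R i = R j \<longleftrightarrow> i = j" "\<Delta> i = \<Delta> j \<longleftrightarrow> i = j" "R i \<noteq> \<Delta> j" by blast+
qed

lemma R_disjoint: "(x, y) \<in> R i \<Longrightarrow> (x, y) \<in> R j \<Longrightarrow> i = j"
  using color_graph_disjoint[OF color_graph_scheme R_mem R_mem] R_eq_iff by metis

lemma \<Delta>_disjoint: "(x, y) \<in> \<Delta> i \<Longrightarrow> (x, y) \<in> \<Delta> j \<Longrightarrow> i = j"
  using color_graph_disjoint[OF color_graph_scheme \<Delta>_mem \<Delta>_mem] \<Delta>_eq_iff by metis

lemma R_\<Delta>_disjoint: "(x, y) \<in> R i \<Longrightarrow> (x, y) \<notin> \<Delta> j"
  using color_graph_disjoint[OF color_graph_scheme R_mem \<Delta>_mem] R_neq_\<Delta> by metis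

lemma thick_iff: "(\<exists>j. (x, y) \<in> \<Delta> j) \<longleftrightarrow> (x, y) \<notin> same_fiber"
proof -
  have "\<Union> {R 0, R 1, R 2, \<Delta> 0, \<Delta> 1, \<Delta> 2} = UNIV"
    using color_graph_scheme by (simp add: color_graph_def partition_on_def)
  then have "(x, y) \<in> \<Union> {R 0, R 1, R 2, \<Delta> 0, \<Delta> 1, \<Delta> 2}" by simp
  then have "(\<exists>k. (x, y) \<in> R k) \<or> (\<exists>j. (x, y) \<in> \<Delta> j)"
    unfolding Union_iff bex_simps by blast
  then show ?thesis using R_\<Delta>_disjoint unfolding same_fiber_iff by metis
qed

lemma R_R: "(x, y) \<in> R i \<Longrightarrow> (y, z) \<in> R j \<Longrightarrow> (x, z) \<in> R (i + j)"
  by (rule adj_mul_eq_adj_comp[OF adj_R_mul_R])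

lemma R_\<Delta>: "(x, y) \<in> R i \<Longrightarrow> (y, z) \<in> \<Delta> j \<Longrightarrow> (x, z) \<in> \<Delta> (i + j)"
  by (rule adj_mul_eq_adj_comp[OF adj_R_mul_\<Delta>])

lemma \<Delta>_R: "(x, y) \<in> \<Delta> j \<Longrightarrow> (y, z) \<in> R i \<Longrightarrow> (x, z) \<in> \<Delta> (j - i)"
  by (rule adj_mul_eq_adj_comp[OF adj_\<Delta>_mul_R])

lemma R_ex1: "\<exists>!y. (x, y) \<in> R k"
proof -
  have "card (R k `` {x}) = 1" using R_valency by (simp add: has_valency_def)
  then obtain y where "R k `` {x} = {y}" by (auto simp: card_1_singleton_iff)
  then have "(x, z) \<in> R k \<longleftrightarrow> z = y" for z by auto
  then show ?thesis by simp
qed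

lemma R_converse: "(x, y) \<in> R k \<Longrightarrow> (y, x) \<in> R (- k)"
proof -
  assume xy: "(x, y) \<in> R k"
  obtain w where w: "(y, w) \<in> R (- k)" using R_ex1 by blast
  then have "(x, w) \<in> R 0" using R_R[OF xy w] by simp
  then show ?thesis using w R_0 by simp
qed

lemma \<Delta>_neighbour: obtains y where "(x, y) \<in> \<Delta> k"
proof -
  have "card (\<Delta> k `` {x}) = m" using \<Delta>_valency by (simp add: has_valency_def)
  then have "\<Delta> k `` {x} \<noteq> {}" using m_gt_1 by (metis card.empty not_less0)
  then show ?thesis using that by blast
qed

lemma equiv_same_fiber: "equiv UNIV same_fiber"
proof (rule equivI)
  show "refl same_fiber" using R_0 by (auto simp: refl_on_def same_fiber_def)
  show "sym same_fiber" unfolding sym_def same_fiber_iff using R_converse by blast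
  show "trans same_fiber" unfolding trans_def same_fiber_iff using R_R by blast
qed auto

lemma same_fiber_sym: "(x, y) \<in> same_fiber \<longleftrightarrow> (y, x) \<in> same_fiber"
  using equiv_same_fiber by (meson equivE symD)

lemma fibers_partition: "partition_on UNIV (fibers R)"
  using partition_on_quotient[OF equiv_same_fiber] by (simp add: fibers_def same_fiber_def)

lemma continent_eq: "continent R island = - island"
  using fibers_partition island_fiber
  unfolding continent_def partition_on_def disjoint_def by blast

lemma island_same_fiber: "x \<in> island \<Longrightarrow> y \<in> island \<longleftrightarrow> (x, y) \<in> same_fiber"
proof -
  assume x: "x \<in> island"
  have "island \<in> UNIV // same_fiber" using island_fiber by (simp add: fibers_def same_fiber_def)
  then obtain a where "island = same_fiber `` {a}" by (auto elim: quotientE)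
  then show ?thesis using x equiv_same_fiber by (meson Image_singleton_iff equivE symD transD)
qed

lemma island_cong: "(x, y) \<in> same_fiber \<Longrightarrow> x \<in> island \<longleftrightarrow> y \<in> island"
  using island_same_fiber same_fiber_sym by metis

lemma no_thick_in_island: "x \<in> island \<Longrightarrow> y \<in> island \<Longrightarrow> (x, y) \<notin> \<Delta> k"
  using island_same_fiber thick_iff by blast

lemma island_nonempty: obtains x where "x \<in> island"
  using fibers_partition island_fiber by (metis partition_on_def equals0I)

lemma sum_adj_\<Delta>: "(\<Sum>k\<in>UNIV. adj (\<Delta> k)) = adj (- same_fiber)"
proof -
  have "(\<Sum>k\<in>UNIV. adj (\<Delta> k) $ x $ y) = adj (- same_fiber) $ x $ y" for x y
  proof (cases "(x, y) \<in> same_fiber")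
    case True
    then show ?thesis using thick_iff[of x y] by simp
  next
    case False
    then obtain j where j: "(x, y) \<in> \<Delta> j" using thick_iff by blast
    then have "(x, y) \<in> \<Delta> k \<longleftrightarrow> k = j" for k using \<Delta>_disjoint by blast
    then show ?thesis using False by simp
  qed
  then show ?thesis by (simp add: vec_eq_iff)
qed

lemma sum_adj_R: "(\<Sum>k\<in>UNIV. adj (R k)) = adj same_fiber"
proof -
  have "(\<Sum>k\<in>UNIV. adj (R k) $ x $ y) = adj same_fiber $ x $ y" for x y
  proof (cases "(x, y) \<in> same_fiber")
    case False
    then show ?thesis using same_fiber_iff[of x y] by simp
  next
    case True
    then obtain j where j: "(x, y) \<in> R j" using same_fiber_iff by blast
    then have "(x, y) \<in> R k \<longleftrightarrow> k = j" for k using R_disjoint by blast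
    then show ?thesis using True by simp
  qed
  then show ?thesis by (simp add: vec_eq_iff)
qed

lemma adj_\<Delta>_mul:
  "adj (\<Delta> i) ** adj (\<Delta> j)
     = real m *\<^sub>R adj (R (i - j)) + ((real m - 1) / 3) *\<^sub>R adj (- same_fiber)"
  unfolding adj_\<Delta>_mul_\<Delta> sum_adj_\<Delta>[symmetric] sum_mod_3 ..

text \<open>
  The diagonal entry \<open>m\<close> of \<open>adj (\<Delta> k) ** adj (\<Delta> k)\<close> counts the out-neighbours of \<open>x\<close> that are also
  in-neighbours, and \<open>m\<close> is the total number of out-neighbours.
\<close>

lemma \<Delta>_sym: "(x, y) \<in> \<Delta> k \<Longrightarrow> (y, x) \<in> \<Delta> k"
proof -
  assume xy: "(x, y) \<in> \<Delta> k"
  have "(x, x) \<in> same_fiber" using R_0 by (simp add: same_fiber_def)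
  then have "real m = (adj (\<Delta> k) ** adj (\<Delta> k)) $ x $ x"
    unfolding adj_\<Delta>_mul by (simp add: R_0)
  also have "\<dots> = (\<Sum>y\<in>UNIV. if (x, y) \<in> \<Delta> k \<and> (y, x) \<in> \<Delta> k then 1 else 0)"
    unfolding matrix_mul_nth by (rule sum.cong) auto
  also have "\<dots> = real (card {y. (x, y) \<in> \<Delta> k \<and> (y, x) \<in> \<Delta> k})"
    by (simp add: sum.If_cases)
  finally have "card {y. (x, y) \<in> \<Delta> k \<and> (y, x) \<in> \<Delta> k} = card (\<Delta> k `` {x})"
    using \<Delta>_valency by (simp add: has_valency_def)
  then have "{y. (x, y) \<in> \<Delta> k \<and> (y, x) \<in> \<Delta> k} = \<Delta> k `` {x}"
    by (intro card_subset_eq) auto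
  then show ?thesis using xy by blast
qed

section \<open>The switched relations\<close>

text \<open>
  Modulo 3 both new relations of the switching, and also \<open>\<Delta> 0\<close>, have this one form: the bridge
  carries the negated index.
\<close>

definition switched :: "3 \<Rightarrow> 'v rel" where
  "switched i = continent_part R \<Delta> island i \<union> bridge R \<Delta> island (- i)"

definition bridge_sign :: "'v \<Rightarrow> 'v \<Rightarrow> 3 \<Rightarrow> 3" where
  "bridge_sign x y i = (if x \<in> island \<longleftrightarrow> y \<in> island then i else - i)"

lemma switched_iff: "(x, y) \<in> switched i \<longleftrightarrow> (x, y) \<in> \<Delta> (bridge_sign x y i)"
  using no_thick_in_island[of x y]
  by (auto simp: switched_def continent_part_def bridge_def continent_eq bridge_sign_def)

lemma adj_switched_nth: "adj (switched i) $ x $ y = adj (\<Delta> (bridge_sign x y i)) $ x $ y"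
  by (simp add: switched_iff)

lemma switching0_eq:
  "switching0 R \<Delta> island = {Id, same_fiber - Id, switched 0, switched 1, switched 2}"
proof -
  have "\<Delta> 0 = switched 0"
    by (auto simp: switched_iff bridge_sign_def split: if_splits)
  moreover have "R 1 \<union> R 2 = same_fiber - Id"
    using R_disjoint[of _ _ 0] unfolding R_0[symmetric] same_fiber_def by fastforce
  ultimately show ?thesis by (simp only: switching0_def switched_def uminus_mod_3)
qed

lemma switched_sym: "(x, y) \<in> switched i \<Longrightarrow> (y, x) \<in> switched i"
  using \<Delta>_sym by (auto simp: switched_iff bridge_sign_def split: if_splits)

lemma switched_disjoint: "(x, y) \<in> switched i \<Longrightarrow> (x, y) \<in> switched j \<Longrightarrow> i = j"
  using \<Delta>_disjoint unfolding switched_iff bridge_sign_def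
  by (metis (full_types) minus_equation_iff)

lemma bridge_sign_involution: "bridge_sign x y (bridge_sign x y i) = i"
  by (simp add: bridge_sign_def)

lemma switched_exists_iff: "(\<exists>i. (x, y) \<in> switched i) \<longleftrightarrow> (x, y) \<notin> same_fiber"
proof -
  have "(\<exists>i. (x, y) \<in> switched i) \<longleftrightarrow> (\<exists>j. (x, y) \<in> \<Delta> j)"
    unfolding switched_iff using bridge_sign_involution by metis
  then show ?thesis by (simp add: thick_iff)
qed

lemma switched_nonempty: "switched i \<noteq> {}"
proof -
  obtain x where x: "x \<in> island" by (rule island_nonempty)
  obtain y where y: "(x, y) \<in> \<Delta> (- i)" by (rule \<Delta>_neighbour)
  then have "(x, y) \<in> switched i"
    using no_thick_in_island[OF x] x by (auto simp: switched_iff bridge_sign_def)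
  then show ?thesis by blast
qed

lemma same_fiber_minus_Id_nonempty: "same_fiber - Id \<noteq> {}"
proof -
  obtain x y where "(x, y) \<in> R 1" using R_ex1 by blast
  then have "(x, y) \<in> same_fiber - Id"
    using R_disjoint[of x y 0 1] R_0 by (auto simp: same_fiber_def)
  then show ?thesis by blast
qed

lemma sum_adj_switched: "(\<Sum>i\<in>UNIV. adj (switched i)) = adj (- same_fiber)"
proof -
  have "(\<Sum>i\<in>UNIV. adj (switched i) $ x $ y) = adj (- same_fiber) $ x $ y" for x y
  proof -
    have "(\<Sum>i\<in>UNIV. adj (switched i) $ x $ y) = (\<Sum>i\<in>UNIV. adj (\<Delta> i) $ x $ y)"
      using sum_uminus_mod_3[of "\<lambda>i. adj (\<Delta> i) $ x $ y"]
      by (cases "x \<in> island \<longleftrightarrow> y \<in> island")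
        (simp_all add: adj_switched_nth bridge_sign_def del: adj_nth)
    also have "\<dots> = (\<Sum>i\<in>UNIV. adj (\<Delta> i)) $ x $ y" by simp
    finally show ?thesis by (simp only: sum_adj_\<Delta>)
  qed
  then show ?thesis by (simp add: vec_eq_iff)
qed

lemma switched_distinct: "i \<noteq> j \<Longrightarrow> switched i \<noteq> switched j"
proof
  assume "i \<noteq> j" "switched i = switched j"
  moreover obtain x y where "(x, y) \<in> switched i" using switched_nonempty[of i] by auto
  ultimately show False using switched_disjoint[of x y i j] by simp
qed

lemma switched_inter_same_fiber: "switched i \<inter> same_fiber = {}"
  using switched_exists_iff by auto

lemma color_graph_switching: "color_graph (switching0 R \<Delta> island)"
proof -
  have Id_sub: "Id \<subseteq> same_fiber" using R_0 by (auto simp: same_fiber_def)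
  have "\<Union> {Id, same_fiber - Id, switched 0, switched 1, switched 2}
      = same_fiber \<union> (\<Union>i. switched i)"
    unfolding univ_mod_3 using Id_sub by auto
  also have "\<dots> = UNIV" using switched_exists_iff by auto
  finally have cover: "\<Union> {Id, same_fiber - Id, switched 0, switched 1, switched 2} = UNIV" .
  have inter: "switched i \<inter> switched j = {}" if "i \<noteq> j" for i j
    using switched_disjoint that by auto
  have inter': "switched i \<inter> Id = {}" "switched i \<inter> (same_fiber - Id) = {}" for i
    using switched_inter_same_fiber[of i] Id_sub by auto
  have "disjoint {Id, same_fiber - Id, switched 0, switched 1, switched 2}"
    unfolding disjoint_def using inter inter' by (auto simp: Int_commute)
  then show ?thesis
    unfolding switching0_eq color_graph_def partition_on_def
    using cover switched_nonempty same_fiber_minus_Id_nonempty by auto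
qed

lemma rank_switching: "scheme_rank (switching0 R \<Delta> island) = 5"
proof -
  have "Id \<noteq> switched i" "same_fiber - Id \<noteq> switched i" for i
    using switched_inter_same_fiber[of i] switched_nonempty[of i] R_0
    by (auto simp: same_fiber_def)
  moreover have "Id \<noteq> same_fiber - Id" by auto
  ultimately show ?thesis
    unfolding scheme_rank_def switching0_eq by (simp add: switched_distinct)
qed

section \<open>Products of switched relations\<close>

definition paths_via_island :: "3 \<Rightarrow> 3 \<Rightarrow> 'v \<Rightarrow> 'v \<Rightarrow> real" where
  "paths_via_island i j x y = (\<Sum>z\<in>island. adj (\<Delta> i) $ x $ z * adj (\<Delta> j) $ z $ y)"

text \<open>
  Moving the middle vertex of a path along \<open>R (i + j)\<close>, which permutes the island, turns the
  colors \<open>i, j\<close> of its two edges into \<open>- j, - i\<close>.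
\<close>

lemma paths_via_island_reflect: "paths_via_island i j x y = paths_via_island (- j) (- i) x y"
proof -
  define \<rho> where "\<rho> k z = (THE z'. (z, z') \<in> R k)" for k z
  have \<rho>: "(z, \<rho> k z) \<in> R k" for k z
    unfolding \<rho>_def using theI'[OF R_ex1] .
  have \<rho>_inverse: "\<rho> (- k) (\<rho> k z) = z" for k z
    using R_converse[OF \<rho>[of z k]] \<rho>[of "\<rho> k z" "- k"] R_ex1 by blast
  have \<rho>_island: "\<rho> k z \<in> island" if "z \<in> island" for k z
    using that \<rho> island_cong same_fiber_iff by blast
  have 1: "(x, \<rho> k z) \<in> \<Delta> (i - k) \<longleftrightarrow> (x, z) \<in> \<Delta> i" for x z i k
    using \<Delta>_R[OF _ \<rho>[of z k], of x i]
      \<Delta>_R[OF _ R_converse[OF \<rho>[of z k]], of x "i - k"] by auto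
  have 2: "(\<rho> k z, y) \<in> \<Delta> (j - k) \<longleftrightarrow> (z, y) \<in> \<Delta> j" for y z j k
    using 1[of y k z j] \<Delta>_sym by blast
  show ?thesis
    unfolding paths_via_island_def
  proof (rule sum.reindex_bij_witness[where i = "\<rho> (- (i + j))" and j = "\<rho> (i + j)"])
    fix z
    show "\<rho> (- (i + j)) (\<rho> (i + j) z) = z" by (rule \<rho>_inverse)
    show "\<rho> (i + j) (\<rho> (- (i + j)) z) = z" using \<rho>_inverse[of "- (i + j)" z] by (simp only: minus_minus)
    show "adj (\<Delta> (- j)) $ x $ \<rho> (i + j) z * adj (\<Delta> (- i)) $ \<rho> (i + j) z $ y
        = adj (\<Delta> i) $ x $ z * adj (\<Delta> j) $ z $ y"
      using 1[of x "i + j" z i] 2[of "i + j" z y j] by simp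
  qed (use \<rho>_island in auto)
qed

text \<open>
  A path from a point of the island must leave it and a path to a point of the island must enter
  it, so when an end of the path lies on the island the signs of both edges are determined by the
  ends. This includes the vanishing products with the middle vertex on the island.
\<close>

lemma switched_mul_at_island:
  assumes "x \<in> island \<or> y \<in> island"
  shows "(adj (switched i) ** adj (switched j)) $ x $ y
    = (adj (\<Delta> (if x \<in> island then - i else i)) ** adj (\<Delta> (if y \<in> island then - j else j))) $ x $ y"
  unfolding matrix_mul_nth
proof (rule sum.cong)
  fix z
  show "adj (switched i) $ x $ z * adj (switched j) $ z $ y =
    adj (\<Delta> (if x \<in> island then - i else i)) $ x $ z *
    adj (\<Delta> (if y \<in> island then - j else j)) $ z $ y"
    using assms no_thick_in_island[of x z] no_thick_in_island[of z y]
    by (cases "z \<in> island") (auto simp: switched_iff bridge_sign_def)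
qed simp

lemma switched_mul_on_continent:
  assumes "x \<notin> island" "y \<notin> island"
  shows "(adj (switched i) ** adj (switched j)) $ x $ y
    = (adj (\<Delta> i) ** adj (\<Delta> j)) $ x $ y
      + paths_via_island (- i) (- j) x y - paths_via_island i j x y"
proof -
  have split: "(A ** B) $ x $ y = (\<Sum>z\<in>island. A $ x $ z * B $ z $ y)
      + (\<Sum>z\<in>- island. A $ x $ z * B $ z $ y)" for A B :: "real^'v^'v"
    unfolding matrix_mul_nth Compl_eq_Diff_UNIV by (subst add.commute, rule sum.subset_diff) auto
  have "(\<Sum>z\<in>island. adj (switched i) $ x $ z * adj (switched j) $ z $ y)
      = paths_via_island (- i) (- j) x y"
    unfolding paths_via_island_def using assms
    by (intro sum.cong) (simp_all add: adj_switched_nth bridge_sign_def del: adj_nth)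
  moreover have "(\<Sum>z\<in>- island. adj (switched i) $ x $ z * adj (switched j) $ z $ y)
      = (\<Sum>z\<in>- island. adj (\<Delta> i) $ x $ z * adj (\<Delta> j) $ z $ y)"
    using assms by (intro sum.cong) (simp_all add: adj_switched_nth bridge_sign_def del: adj_nth)
  ultimately show ?thesis
    unfolding split[of "adj (switched i)"] split[of "adj (\<Delta> i)"]
    by (simp add: paths_via_island_def)
qed

text \<open>
  Symmetrizing removes the dependence on the island: the corrections on the continent cancel by the
  reflection of paths, on the island negating the indices exchanges \<open>R (i - j)\<close> with \<open>R (j - i)\<close>, and
  between island and continent the \<open>R\<close>-terms are zero.
\<close>

lemma switched_anticommutator:
  "adj (switched i) ** adj (switched j) + adj (switched j) ** adj (switched i)
     = real m *\<^sub>R (adj (R (i - j)) + adj (R (j - i)))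
       + (2 * (real m - 1) / 3) *\<^sub>R adj (- same_fiber)"
proof -
  have "(adj (switched i) ** adj (switched j)) $ x $ y
        + (adj (switched j) ** adj (switched i)) $ x $ y
      = real m * (adj (R (i - j)) $ x $ y + adj (R (j - i)) $ x $ y)
        + (2 * (real m - 1) / 3) * adj (- same_fiber) $ x $ y" for x y
  proof (cases "x \<in> island \<or> y \<in> island")
    case True
    show ?thesis
    proof (cases "x \<in> island \<and> y \<in> island")
      case True
      then show ?thesis
        by (simp add: switched_mul_at_island adj_\<Delta>_mul field_simps del: adj_nth)
    next
      case False
      with True have "(x, y) \<notin> same_fiber" using island_cong by blast
      then show ?thesis
        unfolding switched_mul_at_island[OF True] adj_\<Delta>_mul
        by (simp add: same_fiber_iff)
    qed
  next
    case False
    then show ?thesis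
      using paths_via_island_reflect[of "- i" "- j" x y] paths_via_island_reflect[of i j x y]
      by (simp add: switched_mul_on_continent adj_\<Delta>_mul field_simps del: adj_nth)
  qed
  then show ?thesis by (simp add: vec_eq_iff del: adj_nth)
qed

text \<open>
  All points of the fiber of \<open>x\<close> lie on the same side as \<open>x\<close>, so the edges from that fiber to \<open>y\<close>
  all keep or all negate their index, and the product is an entry of the product in the scheme.
\<close>

lemma same_fiber_mul_switched: "adj same_fiber ** adj (switched i) = adj (- same_fiber)"
proof -
  have "adj same_fiber ** adj (\<Delta> i) = adj (- same_fiber)" for i
  proof -
    have "adj same_fiber ** adj (\<Delta> i) = (\<Sum>k\<in>UNIV. adj (R k) ** adj (\<Delta> i))"
      unfolding sum_adj_R[symmetric] sum_mod_3 by (simp add: matrix_add_rdistrib)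
    also have "\<dots> = (\<Sum>k\<in>UNIV. adj (\<Delta> (k + i)))"
      by (simp only: adj_R_mul_\<Delta>)
    finally show ?thesis
      using sum_shift_mod_3[of "\<lambda>k. adj (\<Delta> k)"] sum_adj_\<Delta> by simp
  qed
  moreover have "(adj same_fiber ** adj (switched i)) $ x $ y
      = (adj same_fiber ** adj (\<Delta> (bridge_sign x y i))) $ x $ y" for x y
    unfolding matrix_mul_nth
    by (rule sum.cong) (auto simp: switched_iff bridge_sign_def dest: island_cong)
  ultimately show ?thesis by (simp add: vec_eq_iff)
qed

lemma switched_mul_same_fiber: "adj (switched i) ** adj same_fiber = adj (- same_fiber)"
proof -
  have "(switched i)\<inverse> = switched i" using switched_sym by auto
  moreover have "same_fiber\<inverse> = same_fiber" using same_fiber_sym by auto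
  moreover have "(- same_fiber)\<inverse> = - same_fiber" using same_fiber_sym by auto
  ultimately show ?thesis
    using arg_cong[OF same_fiber_mul_switched[of i], of transpose]
    by (simp add: matrix_transpose_mul transpose_adj)
qed

lemma same_fiber_mul_same_fiber: "adj same_fiber ** adj same_fiber = 3 *\<^sub>R adj same_fiber"
proof -
  have "adj same_fiber ** adj (R i) = adj same_fiber" for i
  proof -
    have "adj same_fiber ** adj (R i) = (\<Sum>k\<in>UNIV. adj (R k) ** adj (R i))"
      unfolding sum_adj_R[symmetric] sum_mod_3 by (simp add: matrix_add_rdistrib)
    also have "\<dots> = (\<Sum>k\<in>UNIV. adj (R (k + i)))"
      by (simp only: adj_R_mul_R)
    finally show ?thesis
      using sum_shift_mod_3[of "\<lambda>k. adj (R k)"] sum_adj_R by simp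
  qed
  then have "(\<Sum>i\<in>UNIV. adj same_fiber ** adj (R i)) = (\<Sum>i\<in>(UNIV::3 set). adj same_fiber)"
    by simp
  then show ?thesis
    unfolding sum_mod_3 matrix_add_ldistrib[symmetric]
    by (simp add: sum_adj_R[symmetric] sum_mod_3 vec_eq_iff)
qed

lemma adj_Id: "adj Id = mat 1"
  by (auto simp: vec_eq_iff mat_def)

lemma adj_same_fiber_minus_Id: "adj (same_fiber - Id) = adj same_fiber - mat 1"
  using R_0 by (auto simp: vec_eq_iff mat_def same_fiber_def)

theorem jordan_scheme_switching: "jordan_scheme (switching0 R \<Delta> island)"
proof -
  let ?V = "span (adj ` switching0 R \<Delta> island)"
  let ?K = "adj same_fiber" and ?S = "\<lambda>i. adj (switched i)"
  have I: "mat 1 \<in> ?V"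
    unfolding adj_Id[symmetric] by (auto simp: switching0_eq intro: span_base)
  have KI: "?K - mat 1 \<in> ?V"
    unfolding adj_same_fiber_minus_Id[symmetric] by (auto simp: switching0_eq intro: span_base)
  then have K: "?K \<in> ?V" using span_add[OF I KI] by simp
  have S: "?S i \<in> ?V" for i
    using exhaust_mod_3[of i] by (auto simp: switching0_eq intro: span_base)
  then have N: "adj (- same_fiber) \<in> ?V"
    unfolding sum_adj_switched[symmetric] by (rule span_sum)
  have R: "adj (R k) + adj (R (- k)) \<in> ?V" for k
  proof (cases "k = 0")
    case True
    then show ?thesis using span_add[OF I I] by (simp add: R_0 adj_Id)
  next
    case False
    then have "adj (R k) + adj (R (- k)) = (\<Sum>i\<in>UNIV. adj (R i)) - adj (R 0)"
      unfolding sum_mod_3 using exhaust_mod_3[of k] by (auto simp only: uminus_mod_3) simp_all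
    then show ?thesis using KI by (simp add: sum_adj_R R_0 adj_Id)
  qed
  have I_mul: "jordan_product (mat 1) A = A" for A :: "real^'v^'v"
    by (simp add: jordan_product_def vec_eq_iff)
  have K_K: "jordan_product ?K ?K = 3 *\<^sub>R ?K"
    by (simp add: jordan_product_def same_fiber_mul_same_fiber vec_eq_iff)
  have K_S: "jordan_product ?K (?S i) = adj (- same_fiber)" for i
    by (simp add: jordan_product_def same_fiber_mul_switched switched_mul_same_fiber vec_eq_iff)
  have S_S: "jordan_product (?S i) (?S j) \<in> ?V" for i j
    unfolding jordan_product_def switched_anticommutator
    using R[of "i - j"] by (intro span_scale span_add[OF span_scale span_scale] N) simp
  \<comment> \<open>Passing from \<open>R 1 \<union> R 2\<close> to \<open>same_fiber\<close> does not change the span, and \<open>same_fiber\<close> has the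
      simpler products.\<close>
  let ?G = "{mat 1, ?K, ?S 0, ?S 1, ?S 2}"
  have V_eq: "?V = span ?G"
  proof (rule span_eq[THEN iffD2, OF conjI])
    show "adj ` switching0 R \<Delta> island \<subseteq> span ?G"
      by (auto simp: switching0_eq adj_Id adj_same_fiber_minus_Id intro: span_base span_diff)
    show "?G \<subseteq> ?V" using I K S by auto
  qed
  have gens: "jordan_product A B \<in> ?V" if "A \<in> ?G" "B \<in> ?G" for A B
  proof -
    have G_V: "C \<in> ?V" if "C \<in> ?G" for C
      unfolding V_eq using that by (rule span_base)
    have S_K: "jordan_product (?S i) ?K = adj (- same_fiber)" for i
      by (subst jordan_product_commute) (rule K_S)
    have mul_I: "jordan_product C (mat 1) = C" for C :: "real^'v^'v"
      by (subst jordan_product_commute) (rule I_mul)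
    have cases: "C = mat 1 \<or> C = ?K \<or> (\<exists>i. C = ?S i)" if "C \<in> ?G" for C
      using that by blast
    from cases[OF that(1)] cases[OF that(2)] consider
        "A = mat 1" | "B = mat 1" | "A = ?K" "B = ?K" | i where "A = ?K" "B = ?S i"
      | i where "A = ?S i" "B = ?K" | i j where "A = ?S i" "B = ?S j"
      by metis
    then show ?thesis
    proof cases
      case 1
      show ?thesis unfolding 1 I_mul using G_V[OF that(2)] .
    next
      case 2
      show ?thesis unfolding 2 mul_I using G_V[OF that(1)] .
    next
      case 3
      show ?thesis unfolding 3 K_K using K by (rule span_scale)
    next
      case 4
      show ?thesis unfolding 4 K_S by (rule N)
    next
      case 5
      show ?thesis unfolding 5 S_K by (rule N)
    next
      case 6
      show ?thesis unfolding 6 by (rule S_S)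
    qed
  qed
  have "jordan_product A B \<in> ?V" if "A \<in> ?V" "B \<in> ?V" for A B
    using jordan_product_span[of ?G A B] gens that unfolding V_eq by blast
  moreover have "\<forall>S\<in>switching0 R \<Delta> island. sym S"
    unfolding switching0_eq sym_def using same_fiber_sym switched_sym by auto
  ultimately show ?thesis
    using color_graph_switching by (simp add: jordan_scheme_def)
qed

section \<open>Properness\<close>

text \<open>
  Running through a fiber along the thin relations shifts the color of the edge from an outside
  point, so each of the three colors occurs once.
\<close>

lemma island_neighbour_ex1:
  assumes "u \<notin> island"
  shows "\<exists>!z. z \<in> island \<and> (u, z) \<in> \<Delta> 0"
proof (rule ex_ex1I)
  obtain w where w: "w \<in> island" by (rule island_nonempty)
  then have "(u, w) \<notin> same_fiber" using assms island_cong by blast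
  then obtain j where j: "(u, w) \<in> \<Delta> j" using thick_iff by blast
  obtain z where z: "(w, z) \<in> R j" using R_ex1 by blast
  then have "z \<in> island" using w island_cong same_fiber_iff by blast
  then show "\<exists>z. z \<in> island \<and> (u, z) \<in> \<Delta> 0" using \<Delta>_R[OF j z] by auto
next
  fix z z' assume z: "z \<in> island \<and> (u, z) \<in> \<Delta> 0" and z': "z' \<in> island \<and> (u, z') \<in> \<Delta> 0"
  then obtain k where k: "(z, z') \<in> R k" using island_same_fiber same_fiber_iff by blast
  then have "(u, z') \<in> \<Delta> (0 - k)" using z \<Delta>_R by blast
  then have "k = 0" using z' \<Delta>_disjoint[of u z' 0 "- k"] by auto
  then show "z = z'" using k R_0 by simp
qed

lemma paths_via_island_in_fiber:
  assumes "u \<notin> island" "(u, v) \<in> R k"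
  shows "paths_via_island 0 j u v = (if j = - k then 1 else 0)"
proof -
  obtain z\<^sub>0 where z\<^sub>0: "z\<^sub>0 \<in> island" "(u, z\<^sub>0) \<in> \<Delta> 0"
    and uniq: "\<And>z. z \<in> island \<Longrightarrow> (u, z) \<in> \<Delta> 0 \<Longrightarrow> z = z\<^sub>0"
    using island_neighbour_ex1[OF assms(1)] by blast
  have "(z\<^sub>0, v) \<in> \<Delta> (- k)" using \<Delta>_R[OF \<Delta>_sym[OF z\<^sub>0(2)] assms(2)] by simp
  then have "(z\<^sub>0, v) \<in> \<Delta> j \<longleftrightarrow> j = - k" using \<Delta>_disjoint by blast
  moreover have "(u, z) \<in> \<Delta> 0 \<longleftrightarrow> z = z\<^sub>0" if "z \<in> island" for z
    using uniq[OF that] z\<^sub>0(2) by metis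
  ultimately have "paths_via_island 0 j u v
      = (\<Sum>z\<in>island. if z = z\<^sub>0 then if j = - k then 1 else 0 else 0)"
    unfolding paths_via_island_def by (intro sum.cong) simp_all
  then show ?thesis using z\<^sub>0(1) by simp
qed

text \<open>
  The product \<open>adj (switched 0) ** adj (switched 1)\<close> takes the value \<open>m\<close> inside the island, while
  between distinct points of a fiber of the continent its values are \<open>1\<close> and \<open>m - 1\<close>. So the value
  \<open>m\<close> on \<open>R 1 \<union> R 2\<close> is missing in the rows of the continent.
\<close>

theorem switching_not_symmetrization:
  assumes "association_scheme A"
  shows "switching0 R \<Delta> island \<noteq> symmetrization A"
proof
  assume eq: "switching0 R \<Delta> island = symmetrization A"
  let ?M = "adj (switched 0) ** adj (switched 1)"
  obtain x where x: "x \<in> island" by (rule island_nonempty)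
  obtain y where y: "(x, y) \<in> R 1" using R_ex1 by blast
  have y_island: "y \<in> island" using x y island_same_fiber same_fiber_iff by blast
  have xy: "(x, y) \<in> same_fiber - Id"
    using y R_disjoint[of x y 0 1] R_0 by (auto simp: same_fiber_def)
  have value_xy: "?M $ x $ y = real m"
    unfolding switched_mul_at_island[OF disjI1[OF x]] adj_\<Delta>_mul using x y_island y xy by simp
  obtain u where u: "u \<notin> island"
    using \<Delta>_neighbour[of x 0] no_thick_in_island[OF x] by blast
  have "switched 0 \<in> switching0 R \<Delta> island" "switched 1 \<in> switching0 R \<Delta> island"
    "same_fiber - Id \<in> switching0 R \<Delta> island"
    by (simp_all add: switching0_eq)
  then obtain v where v: "(u, v) \<in> same_fiber - Id" "?M $ u $ v = ?M $ x $ y"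
    using symmetrization_row_values[OF assms eq color_graph_switching] xy by metis
  then obtain k where k: "(u, v) \<in> R k" using same_fiber_iff by blast
  have v_continent: "v \<notin> island" using u v(1) island_cong by blast
  have R_uv: "(u, v) \<in> R i \<longleftrightarrow> i = k" for i using k R_disjoint by blast
  have value_uv: "?M $ u $ v = real m * (if k = 2 then 1 else 0)
      + (if k = 1 then 1 else 0) - (if k = 2 then 1 else 0)"
    unfolding switched_mul_on_continent[OF u v_continent] adj_\<Delta>_mul
    using v(1) exhaust_mod_3[of k]
    by (auto simp: R_uv paths_via_island_in_fiber[OF u k])
  have "k \<noteq> 0" using k v(1) R_0 by auto
  then have "?M $ u $ v = 1 \<or> ?M $ u $ v = real m - 1"
    using value_uv exhaust_mod_3[of k] by auto
  then have "real m = 1 \<or> real m = real m - 1" unfolding v(2) value_xy .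
  then show False using m_gt_1 by simp
qed

end

theorem theorem16p4:
  fixes R \<Delta> :: "3 \<Rightarrow> ('v::finite) rel" and m :: nat and island :: "'v set"
  assumes "m > 1" and "3 dvd (m - 1)"
    and "CARD('v) = 3 * (m + 1)"
    and "thin_thick_scheme m R \<Delta>"
    and "island \<in> fibers R"
  shows "scheme_rank (switching0 R \<Delta> island) = 5 \<and>
         proper_jordan_scheme (switching0 R \<Delta> island)"
proof -
  interpret island_switching R \<Delta> m island
    by (rule island_switching.intro[OF assms(1,4,5)])
  show ?thesis
    using rank_switching jordan_scheme_switching switching_not_symmetrization
    by (auto simp: proper_jordan_scheme_def)
qed

end
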